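(* The ideal $\mathcal L$ on $\omega$ generated by lacunary sets is not $\le_K$-homogeneous (in particular, it is not homogeneous).
   Context: An ideal on a set $X$ is a family of subsets of $X$ closed under finite unions and subsets, containing all finite subsets of $X$ and not containing $X$; $\mathcal I^+=\mathcal P(X)\setminus\mathcal I$. A set $A\subseteq\omega$ is lacunary if $\lim_{n}(a_{n+1}-a_n)=\infty$, where $(a_n)$ is the increasing enumeration of $A$; $\mathcal L$ consists of all subsets of finite unions of lacunary sets (and finite sets). For ideals $\mathcal I$ on $X$ and $\mathcal K$ on $Y$, $\mathcal I\le_K\mathcal K$ (Katětov order) means that there is $f:Y\to X$ with $f^{-1}[B]\in\mathcal K$ for all $B\in\mathcal I$; $\mathcal I$ and $\mathcal K$ are isomorphic if there is a bijection $f:Y\to X$ with $f^{-1}[B]\in\mathcal K\iff B\in\mathcal I$. For $A\in\mathcal I^+$, $\mathcal I\restriction A=\{B\cap A:B\in\mathcal I\}$ (an ideal on $A$). $\mathcal I$ is homogeneous if $\mathcal I\restriction A$ is isomorphic to $\mathcal I$ for each $A\in\mathcal I^+$, and $\le_K$-homogeneous if $\mathcal I\restriction A\le_K\mathcal I$ and $\mathcal I\le_K\mathcal I\restriction A$ for each $A\in\mathcal I^+$. *)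

theory Defs
  imports Complex_Main "HOL-Library.Infinite_Set" "HOL-Library.FuncSet"
begin

definition ideal_on :: "'a set \<Rightarrow> 'a set set \<Rightarrow> bool" where
  "ideal_on X I \<longleftrightarrow>
     I \<subseteq> Pow X \<and>
     (\<forall>A\<in>I. \<forall>B\<in>I. A \<union> B \<in> I) \<and>
     (\<forall>A\<in>I. \<forall>B. B \<subseteq> A \<longrightarrow> B \<in> I) \<and>
     (\<forall>A. A \<subseteq> X \<and> finite A \<longrightarrow> A \<in> I) \<and>
     X \<notin> I"

definition positive_sets :: "'a set \<Rightarrow> 'a set set \<Rightarrow> 'a set set" where
  "positive_sets X I = Pow X - I"

definition restrict_ideal :: "'a set set \<Rightarrow> 'a set \<Rightarrow> 'a set set" where
  "restrict_ideal I A = {B \<inter> A | B. B \<in> I}"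

text \<open>
  Families of sets do not carry their underlying set, so the relations below take it as an
  argument: \<open>X\<close> for \<open>I\<close> and \<open>Y\<close> for \<open>K\<close>. Preimages are cut down to \<open>Y\<close>, the domain of the map.
\<close>

definition katetov_le :: "'a set \<Rightarrow> 'a set set \<Rightarrow> 'b set \<Rightarrow> 'b set set \<Rightarrow> bool" where
  "katetov_le X I Y K \<longleftrightarrow> (\<exists>f \<in> Y \<rightarrow> X. \<forall>B\<in>I. f -` B \<inter> Y \<in> K)"

definition ideal_isomorphic :: "'a set \<Rightarrow> 'a set set \<Rightarrow> 'b set \<Rightarrow> 'b set set \<Rightarrow> bool" where
  "ideal_isomorphic X I Y K \<longleftrightarrow>
     (\<exists>f. bij_betw f Y X \<and> (\<forall>B. B \<subseteq> X \<longrightarrow> (f -` B \<inter> Y \<in> K \<longleftrightarrow> B \<in> I)))"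

definition homogeneous :: "'a set \<Rightarrow> 'a set set \<Rightarrow> bool" where
  "homogeneous X I \<longleftrightarrow>
     (\<forall>A \<in> positive_sets X I. ideal_isomorphic A (restrict_ideal I A) X I)"

definition katetov_homogeneous :: "'a set \<Rightarrow> 'a set set \<Rightarrow> bool" where
  "katetov_homogeneous X I \<longleftrightarrow>
     (\<forall>A \<in> positive_sets X I.
        katetov_le A (restrict_ideal I A) X I \<and> katetov_le X I A (restrict_ideal I A))"

text \<open>
  Only an infinite set has an increasing enumeration indexed by all of \<open>nat\<close>. The truncated
  subtraction is harmless because \<^const>\<open>enumerate\<close> is strictly increasing on infinite sets.
\<close>

definition lacunary :: "nat set \<Rightarrow> bool" where
  "lacunary A \<longleftrightarrow>
     infinite A \<and> filterlim (\<lambda>n. enumerate A (Suc n) - enumerate A n) at_top sequentially"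

definition lacunary_ideal :: "nat set set" where
  "lacunary_ideal =
     {B. \<exists>\<F> C. finite \<F> \<and> (\<forall>A\<in>\<F>. lacunary A) \<and> finite C \<and> B \<subseteq> \<Union>\<F> \<union> C}"

lemma lacunary_gap:
  assumes "lacunary A"
  shows "\<exists>N. \<forall>x\<in>A. \<forall>y\<in>A. N \<le> x \<and> x < y \<longrightarrow> k < y - x"
proof -
  have inf: "infinite A" and lim: "filterlim (\<lambda>n. enumerate A (Suc n) - enumerate A n) at_top sequentially"
    using assms by (auto simp: lacunary_def)
  have "\<forall>\<^sub>F n in sequentially. Suc k \<le> enumerate A (Suc n) - enumerate A n"
    using lim by (simp add: filterlim_at_top)
  then obtain M where M: "\<And>n. n \<ge> M \<Longrightarrow> Suc k \<le> enumerate A (Suc n) - enumerate A n"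
    by (auto simp: eventually_sequentially)
  show ?thesis
  proof (intro exI[of _ "enumerate A M"] ballI impI)
    fix x y assume xA: "x \<in> A" and yA: "y \<in> A" and xy: "enumerate A M \<le> x \<and> x < y"
    obtain m where m: "x = enumerate A m" using enumerate_Ex[OF inf xA] by blast
    obtain n where n: "y = enumerate A n" using enumerate_Ex[OF inf yA] by blast
    have "M \<le> m" using xy m inf by (simp add: enumerate_mono_le_iff)
    moreover have "Suc m \<le> n" using xy m n inf by (simp add: Suc_le_eq)
    then have "enumerate A (Suc m) \<le> y" using n inf by (simp add: enumerate_mono_le_iff)
    ultimately show "k < y - x" using M[of m] m by linarith
  qed
qed

lemma UNIV_notin_lacunary_ideal: "UNIV \<notin> lacunary_ideal"
proof
  assume "UNIV \<in> lacunary_ideal"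
  then obtain \<F> C where fin: "finite \<F>" and lac: "\<And>A. A \<in> \<F> \<Longrightarrow> lacunary A"
    and C: "finite C" and cov: "UNIV \<subseteq> \<Union>\<F> \<union> C"
    by (auto simp: lacunary_ideal_def)
  define k where "k = card \<F>"
  have "\<forall>A\<in>\<F>. \<exists>N. \<forall>x\<in>A. \<forall>y\<in>A. N \<le> x \<and> x < y \<longrightarrow> k < y - x"
    using lacunary_gap lac by blast
  then obtain N where N: "\<And>A x y. \<lbrakk>A \<in> \<F>; x \<in> A; y \<in> A; N A \<le> x; x < y\<rbrakk> \<Longrightarrow> k < y - x"
    by metis
  define p where "p = Max (insert 0 (N ` \<F> \<union> Suc ` C))"
  have pN: "N A \<le> p" if "A \<in> \<F>" for A
    unfolding p_def using that fin C by (intro Max_ge) auto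
  have pC: "c < p" if "c \<in> C" for c
  proof -
    have "Suc c \<le> p" unfolding p_def using that fin C by (intro Max_ge) auto
    then show ?thesis by simp
  qed
  have "\<forall>x\<in>{p..p+k}. \<exists>A\<in>\<F>. x \<in> A"
  proof
    fix x assume "x \<in> {p..p+k}"
    then have "x \<notin> C" using pC by fastforce
    then show "\<exists>A\<in>\<F>. x \<in> A" using cov by auto
  qed
  then obtain g where g: "\<And>x. x \<in> {p..p+k} \<Longrightarrow> g x \<in> \<F> \<and> x \<in> g x"
    by metis
  have lt: "\<not> x < y" if "x \<in> {p..p+k}" "y \<in> {p..p+k}" "g x = g y" for x y
  proof
    assume "x < y"
    have "N (g x) \<le> x" using pN[of "g x"] g[of x] that by auto
    then have "k < y - x" using N[of "g x" x y] g[of x] g[of y] that \<open>x < y\<close> by auto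
    then show False using that by auto
  qed
  have "inj_on g {p..p+k}"
    proof (rule inj_onI)
    fix x y assume "x \<in> {p..p+k}" "y \<in> {p..p+k}" "g x = g y"
    then show "x = y" using lt[of x y] lt[of y x] by simp
  qed
  moreover have "g ` {p..p+k} \<subseteq> \<F>" using g by auto
  ultimately have "card {p..p+k} \<le> card \<F>" using fin by (rule card_inj_on_le)
  then show False by (simp add: k_def)
qed

lemma lacunary_idealI:
  assumes "finite \<F>" "\<forall>A\<in>\<F>. lacunary A" "finite C" "B \<subseteq> \<Union>\<F> \<union> C"
  shows "B \<in> lacunary_ideal"
  unfolding lacunary_ideal_def mem_Collect_eq using assms by (intro exI conjI)

lemma lacunary_idealE:
  assumes "B \<in> lacunary_ideal"
  obtains \<F> C where "finite \<F>" "\<forall>A\<in>\<F>. lacunary A" "finite C" "B \<subseteq> \<Union>\<F> \<union> C"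
  using assms unfolding lacunary_ideal_def mem_Collect_eq by (elim exE conjE) (rule that)

lemma ideal_on_lacunary_ideal: "ideal_on UNIV lacunary_ideal"
  unfolding ideal_on_def
proof (intro conjI ballI allI impI)
  fix A B assume "A \<in> lacunary_ideal" "B \<in> lacunary_ideal"
  obtain \<F> C where 1: "finite \<F>" "\<forall>A\<in>\<F>. lacunary A" "finite C" "A \<subseteq> \<Union>\<F> \<union> C"
    using \<open>A \<in> lacunary_ideal\<close> by (rule lacunary_idealE)
  obtain \<G> D where 2: "finite \<G>" "\<forall>A\<in>\<G>. lacunary A" "finite D" "B \<subseteq> \<Union>\<G> \<union> D"
    using \<open>B \<in> lacunary_ideal\<close> by (rule lacunary_idealE)
  show "A \<union> B \<in> lacunary_ideal"
    by (rule lacunary_idealI[of "\<F> \<union> \<G>" "C \<union> D"]) (use 1 2 in auto)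
next
  fix A B assume "A \<in> lacunary_ideal" and sub: "B \<subseteq> A"
  obtain \<F> C where 1: "finite \<F>" "\<forall>A\<in>\<F>. lacunary A" "finite C" "A \<subseteq> \<Union>\<F> \<union> C"
    using \<open>A \<in> lacunary_ideal\<close> by (rule lacunary_idealE)
  show "B \<in> lacunary_ideal"
    using 1 subset_trans[OF sub 1(4)] by (intro lacunary_idealI)
next
  fix A :: "nat set" assume "A \<subseteq> UNIV \<and> finite A"
  then show "A \<in> lacunary_ideal"
    by (intro lacunary_idealI[of "{}" A]) auto
qed (simp_all add: UNIV_notin_lacunary_ideal)

lemma ideal_on_restrict_ideal:
  assumes "ideal_on X I" "A \<in> positive_sets X I"
  shows "ideal_on A (restrict_ideal I A)"
proof -
  have I: "\<And>B C. \<lbrakk>B \<in> I; C \<in> I\<rbrakk> \<Longrightarrow> B \<union> C \<in> I" "\<And>B C. \<lbrakk>B \<in> I; C \<subseteq> B\<rbrakk> \<Longrightarrow> C \<in> I"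
    "\<And>B. \<lbrakk>B \<subseteq> X; finite B\<rbrakk> \<Longrightarrow> B \<in> I"
    using assms(1) unfolding ideal_on_def by simp_all
  have A: "A \<subseteq> X" "A \<notin> I"
    using assms(2) by (auto simp: positive_sets_def)
  have mem: "B \<in> restrict_ideal I A \<longleftrightarrow> B \<in> I \<and> B \<subseteq> A" for B
  proof
    assume "B \<in> restrict_ideal I A"
    then obtain C where C: "C \<in> I" "B = C \<inter> A"
      by (auto simp: restrict_ideal_def)
    then show "B \<in> I \<and> B \<subseteq> A"
      using I(2)[of C B] by simp
  next
    assume "B \<in> I \<and> B \<subseteq> A"
    then have "B = B \<inter> A \<and> B \<in> I" by auto
    then show "B \<in> restrict_ideal I A"
      unfolding restrict_ideal_def mem_Collect_eq by (rule exI)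
  qed
  show ?thesis
    unfolding ideal_on_def
  proof (intro conjI ballI allI impI)
    show "restrict_ideal I A \<subseteq> Pow A"
      by (rule subsetI) (simp add: mem)
  next
    fix B C assume "B \<in> restrict_ideal I A" "C \<in> restrict_ideal I A"
    then show "B \<union> C \<in> restrict_ideal I A"
      using I(1)[of B C] by (simp add: mem)
  next
    fix B C assume "B \<in> restrict_ideal I A" "C \<subseteq> B"
    then show "C \<in> restrict_ideal I A"
      using I(2)[of B C] subset_trans[of C B A] by (simp add: mem)
  next
    fix B assume "B \<subseteq> A \<and> finite B"
    then show "B \<in> restrict_ideal I A"
      using I(3)[of B] A(1) subset_trans[of B A X] by (simp add: mem)
  next
    show "A \<notin> restrict_ideal I A"
      using A(2) by (simp add: mem)
  qed
qed

end

theory Submission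
  imports Defs "HOL-Library.Nat_Bijection"
begin

text \<open>
  For every sequence of sets \<open>C\<^sub>k \<in> \<L>\<close> there is a set \<open>B \<notin> \<L>\<close> almost disjoint from all of them,
  because the complement of a set in \<open>\<L>\<close> contains arbitrarily long intervals. We choose a set
  \<open>A \<notin> \<L>\<close> for which this property fails as badly as possible: \<open>A\<close> is the union of sets
  \<open>A\<^sub>k \<in> \<L>\<close>, where \<open>A\<^sub>k\<close> consists of infinitely many arithmetic progressions of length and
  difference \<open>k\<close>, and every subset of \<open>A\<close> almost disjoint from all \<open>A\<^sub>k\<close> is lacunary or finite.
  If \<open>f : \<omega> \<rightarrow> A\<close> witnessed \<open>\<L>\<restriction>A \<le>\<^sub>K \<L>\<close>, then take \<open>B \<notin> \<L>\<close> almost disjoint from all \<open>f\<^sup>-\<^sup>1[A\<^sub>k]\<close>. Its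
  image is almost disjoint from all \<open>A\<^sub>k\<close>, hence in \<open>\<L>\<close>, although its preimage contains \<open>B\<close>.
\<close>

section \<open>Lacunarity without enumerations\<close>

text \<open>This form of lacunarity avoids \<open>enumerate\<close> and also admits finite sets, so
  images that may be finite need no separate treatment.\<close>

definition widely_spaced :: "nat set \<Rightarrow> bool" where
  "widely_spaced S \<longleftrightarrow> (\<forall>k. \<exists>N. \<forall>x\<in>S. \<forall>y\<in>S. N \<le> x \<and> x < y \<longrightarrow> k < y - x)"

lemma widely_spaced_imp_lacunary:
  assumes "widely_spaced S" "infinite S"
  shows "lacunary S"
  unfolding lacunary_def filterlim_at_top
proof (intro conjI allI assms(2))
  fix k
  obtain N where N: "\<And>x y. \<lbrakk>x \<in> S; y \<in> S; N \<le> x; x < y\<rbrakk> \<Longrightarrow> k < y - x"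
    using assms(1) unfolding widely_spaced_def by metis
  show "\<forall>\<^sub>F n in sequentially. k \<le> enumerate S (Suc n) - enumerate S n"
    unfolding eventually_sequentially
  proof (intro exI allI impI)
    fix n assume "N \<le> n"
    then have "N \<le> enumerate S n"
      using le_enumerate[OF assms(2), of n] by linarith
    then show "k \<le> enumerate S (Suc n) - enumerate S n"
      using N[of "enumerate S n" "enumerate S (Suc n)"] assms(2)
      by (simp add: enumerate_in_set enumerate_step less_imp_le)
  qed
qed

lemma widely_spaced_in_lacunary_ideal:
  assumes "widely_spaced S"
  shows "S \<in> lacunary_ideal"
proof (cases "finite S")
  case True
  then show ?thesis by (intro lacunary_idealI[of "{}" S]) auto
next
  case False
  then show ?thesis
    using assms by (intro lacunary_idealI[of "{S}" "{}"]) (auto simp: widely_spaced_imp_lacunary)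
qed

lemma lacunary_ideal_subset:
  assumes "A \<in> lacunary_ideal" "B \<subseteq> A"
  shows "B \<in> lacunary_ideal"
proof -
  have "\<forall>A\<in>lacunary_ideal. \<forall>B. B \<subseteq> A \<longrightarrow> B \<in> lacunary_ideal"
    using ideal_on_lacunary_ideal unfolding ideal_on_def by (elim conjE)
  then show ?thesis using assms by simp
qed

lemma lacunary_ideal_UN:
  assumes "finite I" "\<And>i. i \<in> I \<Longrightarrow> A i \<in> lacunary_ideal"
  shows "(\<Union>i\<in>I. A i) \<in> lacunary_ideal"
  using assms
proof (induction I)
  case empty
  then show ?case using ideal_on_lacunary_ideal unfolding ideal_on_def by auto
next
  case (insert i I)
  then show ?case using ideal_on_lacunary_ideal unfolding ideal_on_def by simp
qed

section \<open>Density of sets in the ideal, and diagonalization\<close>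

text \<open>Far enough out, each of the finitely many lacunary generators meets a window of length
  \<open>m\<close> at most once. So their number serves as \<open>t\<close>, and it does not depend
  on \<open>m\<close>; this independence is what later excludes sets from the ideal.\<close>

lemma lacunary_ideal_window_bound:
  assumes "S \<in> lacunary_ideal"
  shows "\<exists>t. \<forall>m. \<exists>N. \<forall>p\<ge>N. card (S \<inter> {p..<p+m}) \<le> t"
proof -
  obtain \<F> C where fin: "finite \<F>" "finite C" and lac: "\<forall>A\<in>\<F>. lacunary A"
    and S: "S \<subseteq> \<Union>\<F> \<union> C"
    using assms by (rule lacunary_idealE)
  have "\<exists>N. \<forall>p\<ge>N. card (S \<inter> {p..<p+m}) \<le> card \<F>" for m
  proof -
    have "\<forall>A\<in>\<F>. \<exists>N. \<forall>x\<in>A. \<forall>y\<in>A. N \<le> x \<and> x < y \<longrightarrow> m < y - x"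
      using lacunary_gap lac by blast
    then obtain N where N: "\<And>A x y. \<lbrakk>A \<in> \<F>; x \<in> A; y \<in> A; N A \<le> x; x < y\<rbrakk> \<Longrightarrow> m < y - x"
      by metis
    define q where "q = Max (insert 0 (N ` \<F> \<union> Suc ` C))"
    have qN: "N A \<le> q" if "A \<in> \<F>" for A
      unfolding q_def using that fin by (intro Max_ge) auto
    have qC: "Suc c \<le> q" if "c \<in> C" for c
      unfolding q_def using that fin by (intro Max_ge) auto
    have "card (S \<inter> {p..<p+m}) \<le> card \<F>" if "q \<le> p" for p
    proof -
      have one: "card (A \<inter> {p..<p+m}) \<le> 1" if A: "A \<in> \<F>" for A
      proof -
        have "\<not> x < y" if "x \<in> A \<inter> {p..<p+m}" "y \<in> A \<inter> {p..<p+m}" for x y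
        proof
          assume "x < y"
          then have "m < y - x"
            using N[OF A, of x y] qN[OF A] that \<open>q \<le> p\<close> by auto
          then show False using that by auto
        qed
        then have "\<forall>x \<in> A \<inter> {p..<p+m}. \<forall>y \<in> A \<inter> {p..<p+m}. x = y"
          by (meson linorder_neqE_nat)
        then show ?thesis by (simp add: card_le_Suc0_iff_eq)
      qed
      have "S \<inter> {p..<p+m} \<subseteq> (\<Union>A\<in>\<F>. A \<inter> {p..<p+m})"
        using S qC \<open>q \<le> p\<close> by fastforce
      then have "card (S \<inter> {p..<p+m}) \<le> card (\<Union>A\<in>\<F>. A \<inter> {p..<p+m})"
        using fin by (intro card_mono) auto
      also have "\<dots> \<le> (\<Sum>A\<in>\<F>. card (A \<inter> {p..<p+m}))"
        using fin by (intro card_UN_le)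
      also have "\<dots> \<le> (\<Sum>A\<in>\<F>. 1)"
        using one by (intro sum_mono)
      finally show ?thesis by simp
    qed
    then show ?thesis by blast
  qed
  then show ?thesis by blast
qed

lemma lacunary_ideal_long_gap:
  assumes "S \<in> lacunary_ideal"
  shows "\<exists>p\<ge>n. {p..p+n} \<inter> S = {}"
proof (rule ccontr)
  assume "\<not> ?thesis"
  then have hit: "\<exists>x. x \<in> S \<and> p \<le> x \<and> x \<le> p + n" if "n \<le> p" for p
    using that by fastforce
  obtain t where t: "\<And>m. \<exists>N. \<forall>p\<ge>N. card (S \<inter> {p..<p+m}) \<le> t"
    using lacunary_ideal_window_bound[OF assms] by blast
  \<comment> \<open>A window of this length holds \<open>t + 1\<close> consecutive blocks of length
    \<open>n + 1\<close>. Each block is hit by \<open>S\<close>, one point too many.\<close>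
  define m where "m = Suc t * Suc n"
  obtain N where N: "\<And>p. N \<le> p \<Longrightarrow> card (S \<inter> {p..<p+m}) \<le> t"
    using t by blast
  define q where "q = max N n"
  have "\<exists>x. x \<in> S \<and> q + a * Suc n \<le> x \<and> x \<le> q + a * Suc n + n" for a
    by (rule hit) (simp add: q_def)
  then obtain g where g: "\<And>a. g a \<in> S" "\<And>a. q + a * Suc n \<le> g a" "\<And>a. g a \<le> q + a * Suc n + n"
    by metis
  have step: "q + Suc a * Suc n \<le> q + b * Suc n" if "a < b" for a b
    using that by (intro add_left_mono mult_right_mono) auto
  have less: "g a < g b" if "a < b" for a b
    using step[OF that] g(2)[of b] g(3)[of a] by simp
  have "inj_on g {..t}"
    by (rule inj_onI) (metis less less_irrefl linorder_neqE_nat)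
  moreover have "g ` {..t} \<subseteq> S \<inter> {q..<q+m}"
  proof
    fix x assume "x \<in> g ` {..t}"
    then obtain a where a: "x = g a" "a < Suc t" by auto
    show "x \<in> S \<inter> {q..<q+m}"
      using g(1)[of a] g(2)[of a] g(3)[of a] step[OF a(2)] a(1) by (simp add: m_def)
  qed
  ultimately have "card {..t} \<le> card (S \<inter> {q..<q+m})"
    by (intro card_inj_on_le) auto
  then show False using N[of q] by (simp add: q_def)
qed

text \<open>Diagonalization: the \<open>n\<close>-th interval avoids \<open>C 0\<close>, ...,
  \<open>C n\<close>, so \<open>C k\<close> can meet only the intervals with index below
  \<open>k\<close>. The lengths grow, so the union of the intervals violates every window
  bound.\<close>

lemma lacunary_ideal_almost_disjoint_positive:
  fixes C :: "nat \<Rightarrow> nat set"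
  assumes "\<And>k. C k \<in> lacunary_ideal"
  shows "\<exists>B. B \<notin> lacunary_ideal \<and> (\<forall>k. finite (B \<inter> C k))"
proof -
  have "\<exists>p\<ge>n. {p..p+n} \<inter> (\<Union>k\<in>{..n}. C k) = {}" for n
    by (intro lacunary_ideal_long_gap lacunary_ideal_UN assms) auto
  then obtain p where p: "\<And>n. n \<le> p n" "\<And>n. {p n..p n+n} \<inter> (\<Union>k\<in>{..n}. C k) = {}"
    by metis
  define B where "B = (\<Union>n. {p n..p n+n})"
  have "B \<notin> lacunary_ideal"
  proof
    assume "B \<in> lacunary_ideal"
    then obtain t where "\<And>m. \<exists>N. \<forall>q\<ge>N. card (B \<inter> {q..<q+m}) \<le> t"
      using lacunary_ideal_window_bound by blast
    then obtain N where N: "\<And>q. N \<le> q \<Longrightarrow> card (B \<inter> {q..<q + Suc t}) \<le> t"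
      by blast
    \<comment> \<open>The interval with this index has at least \<open>t + 1\<close> points and
      starts beyond \<open>N\<close>.\<close>
    define n where "n = max N t"
    have "{p n..<p n + Suc t} \<subseteq> {p n..p n+n}" by (auto simp: n_def)
    then have "B \<inter> {p n..<p n + Suc t} = {p n..<p n + Suc t}"
      unfolding B_def by blast
    moreover have "N \<le> p n" using p(1)[of n] by (simp add: n_def)
    ultimately show False using N[of "p n"] by simp
  qed
  moreover have "finite (B \<inter> C k)" for k
  proof (rule finite_subset)
    show "B \<inter> C k \<subseteq> (\<Union>n<k. {p n..p n+n})"
    proof
      fix x assume "x \<in> B \<inter> C k"
      then obtain n where n: "x \<in> {p n..p n+n}" "x \<in> C k" by (auto simp: B_def)
      then have "\<not> k \<le> n" using p(2)[of n] by auto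
      then show "x \<in> (\<Union>n<k. {p n..p n+n})" using n(1) by auto
    qed
  qed auto
  ultimately show ?thesis by blast
qed

section \<open>The set with no reduction from the whole ideal\<close>

text \<open>
  The progression starting at \<open>j\<^sup>3\<close> has \<open>k\<close> terms where \<open>k\<close> is the first component of \<open>j\<close>. Hence every
  \<open>k\<close> occurs infinitely often, and \<open>k \<le> j\<close> keeps consecutive progressions far apart.
\<close>

definition prog_len :: "nat \<Rightarrow> nat" where
  "prog_len j = fst (prod_decode j)"

definition prog_level :: "nat \<Rightarrow> nat set" where
  "prog_level k = {j ^ 3 + i * k | i j. i < k \<and> prog_len j = k}"

definition prog_set :: "nat set" where
  "prog_set = (\<Union>k. prog_level k)"

lemma mem_prog_set_iff: "x \<in> prog_set \<longleftrightarrow> (\<exists>i j. x = j ^ 3 + i * prog_len j \<and> i < prog_len j)"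
  by (auto simp: prog_set_def prog_level_def)

lemma prog_len_le: "prog_len j \<le> j"
  unfolding prog_len_def
  by (metis le_prod_encode_1 prod.collapse prod_decode_inverse)

lemma prog_len_prod_encode [simp]: "prog_len (prod_encode (k, l)) = k"
  by (simp add: prog_len_def)

text \<open>The progression starting at \<open>j ^ 3\<close> extends by at most
  \<open>j * j\<close>, so more than \<open>j\<close> separates its end from any later
  progression.\<close>

lemma cube_gap:
  fixes j j' :: nat
  assumes "j < j'"
  shows "j ^ 3 + j * j + j < j' ^ 3"
proof -
  have "j ^ 3 + j * j + j < Suc j ^ 3"
    by (simp add: power3_eq_cube algebra_simps)
  also have "\<dots> \<le> j' ^ 3"
    using assms by (intro power_mono) auto
  finally show ?thesis .
qed

lemma widely_spaced_shifted_cubes: "widely_spaced (range (\<lambda>j. j ^ 3 + c))"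
  unfolding widely_spaced_def
proof (intro allI exI ballI impI)
  fix k x y :: nat
  assume "x \<in> range (\<lambda>j. j ^ 3 + c)" "y \<in> range (\<lambda>j. j ^ 3 + c)" and le: "k ^ 3 + c \<le> x \<and> x < y"
  then obtain j j' where x: "x = j ^ 3 + c" and y: "y = j' ^ 3 + c" by auto
  have "k \<le> j" using le x by (simp add: power_mono_iff)
  moreover have "j < j'"
    using le x y by (auto intro: power_less_imp_less_base[of j 3])
  ultimately show "k < y - x"
    using cube_gap[of j j'] x y by linarith
qed

text \<open>Fixing the index \<open>i\<close> of a term leaves part of a translate of the cubes, and
  only \<open>k\<close> indices occur.\<close>

lemma prog_level_in_lacunary_ideal: "prog_level k \<in> lacunary_ideal"
proof -
  have "(\<Union>i\<in>{..<k}. range (\<lambda>j. j ^ 3 + i * k)) \<in> lacunary_ideal"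
    by (intro lacunary_ideal_UN widely_spaced_in_lacunary_ideal widely_spaced_shifted_cubes) auto
  then show ?thesis
    by (rule lacunary_ideal_subset) (auto simp: prog_level_def)
qed

lemma prog_set_notin_lacunary_ideal: "prog_set \<notin> lacunary_ideal"
proof
  assume "prog_set \<in> lacunary_ideal"
  then obtain t where t: "\<And>m. \<exists>N. \<forall>q\<ge>N. card (prog_set \<inter> {q..<q+m}) \<le> t"
    using lacunary_ideal_window_bound by blast
  define k where "k = Suc t"
  obtain N where N: "\<And>q. N \<le> q \<Longrightarrow> card (prog_set \<inter> {q..<q + k * k}) \<le> t"
    using t by blast
  \<comment> \<open>The progression coded by this pair has \<open>k = t + 1\<close> terms, and it
    starts beyond \<open>N\<close> because a code is at least its second component.\<close>
  define j where "j = prod_encode (k, N)"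
  have "N \<le> j ^ 3"
    using le_prod_encode_2[of N k] self_le_power[of j 3] by (cases "j = 0") (auto simp: j_def)
  have "(\<lambda>i. j ^ 3 + i * k) ` {..<k} \<subseteq> prog_set \<inter> {j ^ 3..<j ^ 3 + k * k}"
  proof
    fix x assume "x \<in> (\<lambda>i. j ^ 3 + i * k) ` {..<k}"
    then obtain i where i: "i < k" "x = j ^ 3 + i * k" by auto
    have "prog_len j = k" by (simp add: j_def)
    then have "x \<in> prog_set" using i mem_prog_set_iff by blast
    then show "x \<in> prog_set \<inter> {j ^ 3..<j ^ 3 + k * k}" using i by simp
  qed
  moreover have "inj_on (\<lambda>i. j ^ 3 + i * k) {..<k}"
    by (auto simp: inj_on_def)
  ultimately have "card {..<k} \<le> card (prog_set \<inter> {j ^ 3..<j ^ 3 + k * k})"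
    by (intro card_inj_on_le) auto
  then show False using N[OF \<open>N \<le> j ^ 3\<close>] by (simp add: k_def)
qed

text \<open>Levels up to \<open>m\<close> contribute only finitely many points. Beyond these, two
  points of one progression differ by at least its difference, which exceeds \<open>m\<close>;
  points of different progressions are separated by \<open>cube_gap\<close>.\<close>

lemma widely_spaced_almost_disjoint_levels:
  assumes sub: "S \<subseteq> prog_set" and fin: "\<And>k. finite (S \<inter> prog_level k)"
  shows "widely_spaced S"
  unfolding widely_spaced_def
proof
  fix m
  have "finite (\<Union>k\<in>{..m}. S \<inter> prog_level k)"
    using fin by (intro finite_UN_I) simp_all
  then obtain N where N: "\<And>x. x \<in> (\<Union>k\<in>{..m}. S \<inter> prog_level k) \<Longrightarrow> x < N"
    unfolding finite_nat_set_iff_bounded by blast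
  have repr: "\<exists>i j. x = j ^ 3 + i * prog_len j \<and> i < prog_len j \<and> m < prog_len j"
    if xS: "x \<in> S" and Nx: "N \<le> x" for x
  proof -
    obtain i j where x: "x = j ^ 3 + i * prog_len j" "i < prog_len j"
      using xS sub mem_prog_set_iff by blast
    then have "x \<in> prog_level (prog_len j)" by (auto simp: prog_level_def)
    then have "m < prog_len j" using N[of x] xS Nx by force
    then show ?thesis using x by blast
  qed
  have "m < y - x" if xS: "x \<in> S" and yS: "y \<in> S" and Nx: "N \<le> x" and "x < y" for x y
  proof -
    obtain i j where x: "x = j ^ 3 + i * prog_len j" "i < prog_len j" "m < prog_len j"
      using repr[OF xS Nx] by blast
    obtain i' j' where y: "y = j' ^ 3 + i' * prog_len j'" "i' < prog_len j'" "m < prog_len j'"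
      using repr[OF yS] Nx \<open>x < y\<close> by auto
    have bound: "i * prog_len j \<le> j * j" "i' * prog_len j' \<le> j' * j'"
      using x(2) y(2) prog_len_le[of j] prog_len_le[of j'] by (auto intro!: mult_mono)
    consider "j = j'" | "j < j'" | "j' < j" by linarith
    then show ?thesis
    proof cases
      case 1
      then have "i < i'" using x y \<open>x < y\<close> by simp
      then have "Suc i * prog_len j \<le> i' * prog_len j" by (intro mult_right_mono) auto
      then show ?thesis using 1 x y by simp
    next
      case 2
      then show ?thesis using cube_gap[OF 2] bound x y prog_len_le[of j] by linarith
    next
      \<comment> \<open>This case is impossible: \<open>y\<close> would lie in an earlier
        progression than \<open>x\<close>.\<close>
      case 3
      then show ?thesis using cube_gap[OF 3] bound x y \<open>x < y\<close> by linarith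
    qed
  qed
  then show "\<exists>N. \<forall>x\<in>S. \<forall>y\<in>S. N \<le> x \<and> x < y \<longrightarrow> m < y - x" by blast
qed

lemma not_katetov_le_prog_set:
  "\<not> katetov_le prog_set (restrict_ideal lacunary_ideal prog_set) UNIV lacunary_ideal"
proof
  assume "katetov_le prog_set (restrict_ideal lacunary_ideal prog_set) UNIV lacunary_ideal"
  then obtain f :: "nat \<Rightarrow> nat" where f: "\<And>x. f x \<in> prog_set"
    and pre: "\<And>B. B \<in> restrict_ideal lacunary_ideal prog_set \<Longrightarrow> f -` B \<in> lacunary_ideal"
    by (auto simp: katetov_le_def)
  have pre': "f -` B \<in> lacunary_ideal" if "B \<in> lacunary_ideal" "B \<subseteq> prog_set" for B
    using that by (intro pre) (auto simp: restrict_ideal_def)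
  have "f -` prog_level k \<in> lacunary_ideal" for k
    by (intro pre' prog_level_in_lacunary_ideal) (auto simp: prog_set_def)
  then obtain B where B: "B \<notin> lacunary_ideal" "\<And>k. finite (B \<inter> f -` prog_level k)"
    using lacunary_ideal_almost_disjoint_positive[of "\<lambda>k. f -` prog_level k"] by blast
  have "f ` B \<inter> prog_level k = f ` (B \<inter> f -` prog_level k)" for k by auto
  then have "widely_spaced (f ` B)"
    using f B(2) by (intro widely_spaced_almost_disjoint_levels) auto
  then have "f -` (f ` B) \<in> lacunary_ideal"
    using f by (intro pre' widely_spaced_in_lacunary_ideal) auto
  then show False
    using B(1) lacunary_ideal_subset[of "f -` (f ` B)" B] by auto
qed

lemma ideal_isomorphic_imp_katetov_le:
  assumes "ideal_isomorphic X I Y K" "I \<subseteq> Pow X"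
  shows "katetov_le X I Y K"
proof -
  obtain f where f: "bij_betw f Y X" "\<And>B. B \<subseteq> X \<Longrightarrow> f -` B \<inter> Y \<in> K \<longleftrightarrow> B \<in> I"
    using assms(1) unfolding ideal_isomorphic_def by metis
  have "f \<in> Y \<rightarrow> X" using bij_betwE[OF f(1)] by auto
  moreover have "f -` B \<inter> Y \<in> K" if "B \<in> I" for B
    using that assms(2) f(2)[of B] by auto
  ultimately show ?thesis unfolding katetov_le_def by (intro bexI ballI)
qed

theorem proposition10p3:
  "\<not> katetov_homogeneous UNIV lacunary_ideal \<and> \<not> homogeneous UNIV lacunary_ideal"
proof -
  have pos: "prog_set \<in> positive_sets UNIV lacunary_ideal"
    using prog_set_notin_lacunary_ideal by (simp add: positive_sets_def)
  have "restrict_ideal lacunary_ideal prog_set \<subseteq> Pow prog_set"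
    by (auto simp: restrict_ideal_def)
  then show ?thesis
    using pos not_katetov_le_prog_set ideal_isomorphic_imp_katetov_le
    unfolding katetov_homogeneous_def homogeneous_def by blast
qed

end
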